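(* For every parabolic quadrilateral in the Euclidean plane there is an invertible affine transformation of the plane that maps it to a parabolic quadrilateral which is simultaneously inscribed and circumscribed.
   Context: A parabolic quadrilateral is the figure that is the intersection of two parts of the plane, each bounded by a parabola (the part bounded by a parabola is the convex region consisting of the parabola and its inside, i.e. the side containing the focus), where the two parabolas meet in four distinct points. Its vertices are these four points. Its sides are the four arcs of the parabolas that make up its boundary, each joining two consecutive vertices. It is called inscribed if its four vertices lie on one circle, and circumscribed if there exists a circle tangent to all four of its sides. An affine transformation maps parabolas to parabolas. *)

theory Defs
  imports "HOL-Analysis.Analysis"
begin

definition is_line :: "(real^2) set \<Rightarrow> bool" where
  "is_line L \<longleftrightarrow> affine L \<and> aff_dim L = 1"

definition parabola :: "real^2 \<Rightarrow> (real^2) set \<Rightarrow> (real^2) set" where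
  "parabola F d = {x. dist x F = infdist x d}"

definition parabola_region :: "real^2 \<Rightarrow> (real^2) set \<Rightarrow> (real^2) set" where
  "parabola_region F d = {x. dist x F \<le> infdist x d}"

(* Q is the figure, V its set of vertices and S its set of sides.  The part of the boundary
   of Q carried by each of the two parabolas consists of two closed arcs, which are its
   connected components; together these are the four sides. *)
definition parabolic_quadrilateral ::
    "(real^2) set \<Rightarrow> (real^2) set \<Rightarrow> (real^2) set set \<Rightarrow> bool" where
  "parabolic_quadrilateral Q V S \<longleftrightarrow>
     (\<exists>F1 d1 F2 d2. is_line d1 \<and> F1 \<notin> d1 \<and> is_line d2 \<and> F2 \<notin> d2 \<and>
        card (parabola F1 d1 \<inter> parabola F2 d2) = 4 \<and>
        Q = parabola_region F1 d1 \<inter> parabola_region F2 d2 \<and>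
        V = parabola F1 d1 \<inter> parabola F2 d2 \<and>
        S = components (parabola F1 d1 \<inter> frontier Q) \<union>
            components (parabola F2 d2 \<inter> frontier Q))"

(* L is the tangent line of the curve C at p, the limit of the secants through p: points of C
   tending to p approach L faster than they approach p. *)
definition tangent_line :: "(real^2) set \<Rightarrow> real^2 \<Rightarrow> (real^2) set \<Rightarrow> bool" where
  "tangent_line C p L \<longleftrightarrow>
     is_line L \<and> p \<in> L \<and> p \<in> C \<and> p islimpt C \<and>
     ((\<lambda>x. infdist x L / dist x p) \<longlongrightarrow> 0) (at p within C)"

definition inscribed :: "(real^2) set \<Rightarrow> bool" where
  "inscribed V \<longleftrightarrow> (\<exists>c r. r > 0 \<and> V \<subseteq> sphere c r)"

(* The sides are closed arcs; contact with the circle has to occur away from their endpoints. *)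
definition circumscribed :: "(real^2) set \<Rightarrow> (real^2) set set \<Rightarrow> bool" where
  "circumscribed V S \<longleftrightarrow>
     (\<exists>c r. r > 0 \<and>
        (\<forall>s\<in>S. \<exists>p\<in>s - V. \<exists>L. tangent_line s p L \<and> tangent_line (sphere c r) p L))"

definition invertible_affine_map :: "(real^2 \<Rightarrow> real^2) \<Rightarrow> bool" where
  "invertible_affine_map f \<longleftrightarrow>
     (\<exists>(A :: real^2^2) b. invertible A \<and> f = (\<lambda>x. A *v x + b))"

end

theory Submission
  imports Defs "HOL-Computational_Algebra.Polynomial"
begin

text \<open>
  Two parabolas with four common points have non-parallel axes, so an affine map turns them into
  \<open>x\<^sup>2 = k (y + a)\<close> and \<open>y\<^sup>2 = q (x + b)\<close> with \<open>k, q > 0\<close>.  Adding the two equations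
  shows that the vertices are concyclic, and this survives any rescaling of the \<open>x\<close>-axis.
  The abscissae \<open>x1 < x2 < x3 < x4\<close> of the vertices are the roots of a quartic of sum \<open>0\<close>; the scale
  is fixed by requiring \<open>x2 + x4 = k\<close>.  The resolvent cubic of the quartic then shows that the
  circle around the origin touching the first parabola where \<open>y = - k/2\<close> also touches the
  second one where \<open>x = - q/2\<close>, and the interlacing of the roots puts one contact point
  on each side.
\<close>

section \<open>Hyperplanes, tangents and affine maps\<close>

lemma infdist_hyperplane:
  fixes a x :: "'a::euclidean_space"
  assumes "a \<noteq> 0"
  shows "infdist x {y. a \<bullet> y = b} = \<bar>a \<bullet> x - b\<bar> / norm a"
proof (rule antisym)
  define p where "p = x - ((a \<bullet> x - b) / (a \<bullet> a)) *\<^sub>R a"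
  have "a \<bullet> p = b" using assms by (simp add: p_def inner_diff_right)
  then have "infdist x {y. a \<bullet> y = b} \<le> dist x p" by (intro infdist_le) simp
  also have "dist x p = \<bar>a \<bullet> x - b\<bar> / norm a"
    using assms by (simp add: p_def dist_norm dot_square_norm power2_eq_square)
  finally show "infdist x {y. a \<bullet> y = b} \<le> \<bar>a \<bullet> x - b\<bar> / norm a" .
  have "\<bar>a \<bullet> x - b\<bar> / norm a \<le> dist x y" if "a \<bullet> y = b" for y
    using Cauchy_Schwarz_ineq2[of a "x - y"] that assms
    by (simp add: inner_diff_right dist_norm divide_le_eq mult.commute)
  then show "\<bar>a \<bullet> x - b\<bar> / norm a \<le> infdist x {y. a \<bullet> y = b}"
    using \<open>a \<bullet> p = b\<close> by (subst infdist_notempty) (auto intro!: cINF_greatest)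
qed

lemma is_line_iff: "is_line L \<longleftrightarrow> (\<exists>a b. a \<noteq> 0 \<and> L = {x. a \<bullet> x = b})"
proof
  assume "is_line L"
  then show "\<exists>a b. a \<noteq> 0 \<and> L = {x. a \<bullet> x = b}"
    using aff_dim_eq_hyperplane[of L] by (simp add: is_line_def affine_hull_eq[THEN iffD2])
next
  assume "\<exists>a b. a \<noteq> 0 \<and> L = {x. a \<bullet> x = b}"
  then show "is_line L"
    by (auto simp: is_line_def affine_hyperplane)
qed

text \<open>A quadratic bound on the deviation from the line makes the quotient in
  \<open>tangent_line\<close> at most a multiple of \<open>dist x p\<close>, which tends to 0. Arcs
  of parabolas and circles both satisfy such a bound, so no derivatives are needed.\<close>

lemma tangent_line_hyperplane:
  assumes "n \<noteq> 0" "p \<in> C" "p islimpt C"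
    and le: "\<And>x. x \<in> C \<Longrightarrow> \<bar>n \<bullet> (x - p)\<bar> \<le> K * (dist x p)\<^sup>2"
  shows "tangent_line C p {x. n \<bullet> x = n \<bullet> p}"
proof -
  have "((\<lambda>x. infdist x {x. n \<bullet> x = n \<bullet> p} / dist x p) \<longlongrightarrow> 0) (at p within C)"
  proof (rule tendsto_sandwich)
    show "\<forall>\<^sub>F x in at p within C. 0 \<le> infdist x {x. n \<bullet> x = n \<bullet> p} / dist x p"
      by (simp add: infdist_nonneg)
    have "infdist x {x. n \<bullet> x = n \<bullet> p} / dist x p \<le> K / norm n * dist x p"
      if "x \<in> C" "x \<noteq> p" for x
      using le[OF that(1)] that assms(1)
      by (simp add: infdist_hyperplane inner_diff_right divide_simps power2_eq_square mult_ac)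
    then show "\<forall>\<^sub>F x in at p within C. infdist x {x. n \<bullet> x = n \<bullet> p} / dist x p \<le> K / norm n * dist x p"
      by (auto simp: eventually_at_filter)
    have "((\<lambda>x. K / norm n * dist x p) \<longlongrightarrow> K / norm n * dist p p) (at p within C)"
      by (intro tendsto_intros)
    then show "((\<lambda>x. K / norm n * dist x p) \<longlongrightarrow> 0) (at p within C)" by simp
  qed auto
  moreover have "is_line {x. n \<bullet> x = n \<bullet> p}" using assms(1) is_line_iff by blast
  ultimately show ?thesis using assms by (simp add: tangent_line_def)
qed

section \<open>Transport of sides and boundaries by affine maps\<close>

lemma homeomorphism_components:
  assumes "homeomorphism A B f g"
  shows "components B = (`) f ` components A"
proof -
  have "f ` A = B" using assms by (auto simp: homeomorphism_def)
  then have "components B = (\<lambda>x. connected_component_set B (f x)) ` A"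
    by (auto simp: components_def)
  also have "\<dots> = (\<lambda>x. f ` connected_component_set A x) ` A"
    using connected_component_set_homeomorphism[OF assms] by (intro image_cong) auto
  finally show ?thesis by (simp add: components_def image_image)
qed

text \<open>The sides are defined through \<open>components\<close> and \<open>frontier\<close>,
  which are purely topological; an invertible affine map is a homeomorphism of the plane and so
  commutes with both.\<close>

lemma
  assumes "invertible_affine_map f"
  shows invertible_affine_map_bij: "bij f"
    and invertible_affine_map_components: "components (f ` T) = (`) f ` components T"
    and invertible_affine_map_frontier: "frontier (f ` T) = f ` frontier T"
proof -
  obtain A b where A: "invertible A" and f: "f = (\<lambda>x. A *v x + b)"
    using assms by (auto simp: invertible_affine_map_def)
  then obtain B where B: "A ** B = mat 1" "B ** A = mat 1" by (auto simp: invertible_def)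
  have hom: "homeomorphism UNIV UNIV f (\<lambda>y. B *v (y - b))"
    by (rule homeomorphismI)
       (auto simp: f matrix_vector_mul_assoc B matrix_vector_mult_diff_distrib intro!: continuous_intros)
  show "bij f" using hom by (intro o_bij[of "\<lambda>y. B *v (y - b)"]) (auto simp: homeomorphism_def fun_eq_iff)
  show "components (f ` T) = (`) f ` components T"
    by (rule homeomorphism_components[OF homeomorphism_of_subsets[OF hom]]) auto
  have "homeomorphic_map euclidean euclidean f"
    unfolding homeomorphic_map_maps homeomorphic_maps_def
    using hom by (intro exI[of _ "\<lambda>y. B *v (y - b)"]) (simp add: homeomorphism_def)
  from homeomorphic_map_frontier_of[OF this, of T] show "frontier (f ` T) = f ` frontier T" by simp
qed

lemma invertible_affine_map_compose:
  assumes "invertible_affine_map f" "invertible_affine_map g"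
  shows "invertible_affine_map (g \<circ> f)"
proof -
  obtain A b A' b' where "invertible A" "f = (\<lambda>x. A *v x + b)" "invertible A'" "g = (\<lambda>x. A' *v x + b')"
    using assms by (auto simp: invertible_affine_map_def)
  then show ?thesis
    unfolding invertible_affine_map_def
    by (intro exI[of _ "A' ** A"] exI[of _ "A' *v b + b'"])
       (auto simp: invertible_mult matrix_vector_mul_assoc algebra_simps)
qed

section \<open>The quartic of the abscissae\<close>

text \<open>Two monic quartics that agree at four points differ by a polynomial of degree at most 3
  with four roots, so they coincide. Comparing coefficients gives Vieta's formulas; the missing
  cubic term makes the sum of the roots 0.\<close>

lemma depressed_quartic_factor:
  fixes c0 c1 c2 x1 x2 x3 x4 :: real
  assumes less: "x1 < x2" "x2 < x3" "x3 < x4"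
    and root: "\<forall>x\<in>{x1, x2, x3, x4}. x^4 + c2 * x\<^sup>2 + c1 * x + c0 = 0"
  shows "x1 + x2 + x3 + x4 = 0"
    and "c2 = x1*x2 + x1*x3 + x1*x4 + x2*x3 + x2*x4 + x3*x4"
    and "c1 = - (x1*x2*x3 + x1*x2*x4 + x1*x3*x4 + x2*x3*x4)"
    and "c0 = x1*x2*x3*x4"
    and "x^4 + c2 * x\<^sup>2 + c1 * x + c0 = (x - x1) * (x - x2) * (x - x3) * (x - x4)"
proof -
  let ?p = "[:c0, c1, c2, 0, 1:]"
  let ?q = "[:- x1, 1:] * [:- x2, 1:] * [:- x3, 1:] * [:- x4, 1:]"
  have eq: "?p = ?q"
  proof (rule poly_eqI_degree_lead_coeff[where n = 4 and A = "{x1, x2, x3, x4}"])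
    show "poly ?p z = poly ?q z" if "z \<in> {x1, x2, x3, x4}" for z
      using root that by (auto simp: power4_eq_xxxx power2_eq_square algebra_simps)
  qed (use less in \<open>auto simp: numeral_eq_Suc\<close>)
  then have "poly ?p x = poly ?q x" by simp
  then show "x^4 + c2 * x\<^sup>2 + c1 * x + c0 = (x - x1) * (x - x2) * (x - x3) * (x - x4)"
    by (simp add: power4_eq_xxxx power2_eq_square algebra_simps)
  from eq show "x1 + x2 + x3 + x4 = 0"
    "c2 = x1*x2 + x1*x3 + x1*x4 + x2*x3 + x2*x4 + x3*x4"
    "c1 = - (x1*x2*x3 + x1*x2*x4 + x1*x3*x4 + x2*x3*x4)"
    "c0 = x1*x2*x3*x4"
    by (simp_all add: algebra_simps)
qed

lemma quartic_nonpos_iff: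
  fixes x x1 x2 x3 x4 :: real
  assumes "x1 < x2" "x2 < x3" "x3 < x4"
  shows "(x - x1) * (x - x2) * (x - x3) * (x - x4) \<le> 0 \<longleftrightarrow> x \<in> {x1..x2} \<union> {x3..x4}"
  unfolding mult_le_0_iff zero_le_mult_iff Un_iff atLeastAtMost_iff using assms by linarith

text \<open>The equation in \<open>root\<close> is \<open>y\<^sup>2 = q * (x + b)\<close> after
  substituting \<open>y = x\<^sup>2 / k - a\<close> and multiplying by \<open>k\<^sup>2\<close>. The
  sign of the product therefore tells on which side of the second parabola a point of the first one
  lies.\<close>

lemma axis_quartic_factor:
  fixes k a q b x1 x2 x3 x4 :: real
  assumes less: "x1 < x2" "x2 < x3" "x3 < x4"
    and root: "\<forall>x\<in>{x1, x2, x3, x4}. (x\<^sup>2 - k * a)\<^sup>2 = k\<^sup>2 * q * (x + b)"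
  shows "x1 + x2 + x3 + x4 = 0"
    and "- 2 * k * a = x1*x2 + x1*x3 + x1*x4 + x2*x3 + x2*x4 + x3*x4"
    and "- k\<^sup>2 * q = - (x1*x2*x3 + x1*x2*x4 + x1*x3*x4 + x2*x3*x4)"
    and "k\<^sup>2 * a\<^sup>2 - k\<^sup>2 * q * b = x1*x2*x3*x4"
    and "(x\<^sup>2 - k * a)\<^sup>2 - k\<^sup>2 * q * (x + b) = (x - x1) * (x - x2) * (x - x3) * (x - x4)"
proof -
  have *: "x^4 + (- 2 * k * a) * x\<^sup>2 + (- k\<^sup>2 * q) * x + (k\<^sup>2 * a\<^sup>2 - k\<^sup>2 * q * b)
      = (x\<^sup>2 - k * a)\<^sup>2 - k\<^sup>2 * q * (x + b)" for x
    by (simp add: power4_eq_xxxx power2_eq_square algebra_simps)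
  with root have "\<forall>x\<in>{x1, x2, x3, x4}.
      x^4 + (- 2 * k * a) * x\<^sup>2 + (- k\<^sup>2 * q) * x + (k\<^sup>2 * a\<^sup>2 - k\<^sup>2 * q * b) = 0"
    by simp
  from depressed_quartic_factor[OF less this, unfolded *] show
    "x1 + x2 + x3 + x4 = 0"
    "- 2 * k * a = x1*x2 + x1*x3 + x1*x4 + x2*x3 + x2*x4 + x3*x4"
    "- k\<^sup>2 * q = - (x1*x2*x3 + x1*x2*x4 + x1*x3*x4 + x2*x3*x4)"
    "k\<^sup>2 * a\<^sup>2 - k\<^sup>2 * q * b = x1*x2*x3*x4"
    "(x\<^sup>2 - k * a)\<^sup>2 - k\<^sup>2 * q * (x + b) = (x - x1) * (x - x2) * (x - x3) * (x - x4)" .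
qed

text \<open>
  Here \<open>(\<plusminus>c, - k/2)\<close> are the contact points on \<open>x\<^sup>2 = k (y + a)\<close>.  The conclusions about
  \<open>y\<close> are the same hypotheses for the other parabola, with the vertices taken
  in the order \<open>x3, x2, x1, x4\<close>.
\<close>
lemma double_contact:
  fixes k a q b x1 x2 x3 x4 :: real
  assumes k: "k > 0" and q: "q > 0" and less: "x1 < x2" "x2 < x3" "x3 < x4"
    and root: "\<forall>x\<in>{x1, x2, x3, x4}. (x\<^sup>2 - k * a)\<^sup>2 = k\<^sup>2 * q * (x + b)"
    and sum: "x2 + x4 = k"
  defines "c \<equiv> sqrt (k * a - k\<^sup>2 / 2)" and "y \<equiv> \<lambda>x. x\<^sup>2 / k - a"
  shows "k * a - k\<^sup>2 / 2 > 0"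
    and "(x\<^sup>2 - k * a)\<^sup>2 \<le> k\<^sup>2 * q * (x + b) \<longleftrightarrow> x \<in> {x1..x2} \<union> {x3..x4}"
    and "(x\<^sup>2 - k * a)\<^sup>2 = k\<^sup>2 * q * (x + b) \<longleftrightarrow> x \<in> {x1, x2, x3, x4}"
    and "c \<in> {x3<..<x4}" "- c \<in> {x1<..<x2}"
    and "y x3 < y x2" "y x2 < y x1" "y x1 < y x4" "y x2 + y x4 = q"
    and "k * a - k\<^sup>2 / 4 = q * b - q\<^sup>2 / 4"
proof -
  note F = axis_quartic_factor[OF less root]
  note eq = F(5)[of x]
  show "(x\<^sup>2 - k * a)\<^sup>2 \<le> k\<^sup>2 * q * (x + b) \<longleftrightarrow> x \<in> {x1..x2} \<union> {x3..x4}"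
    unfolding le_iff_diff_le_0[of "(x\<^sup>2 - k * a)\<^sup>2"] eq by (rule quartic_nonpos_iff[OF less])
  have "(x\<^sup>2 - k * a)\<^sup>2 = k\<^sup>2 * q * (x + b) \<longleftrightarrow> (x - x1) * (x - x2) * (x - x3) * (x - x4) = 0"
    using eq by linarith
  then show "(x\<^sup>2 - k * a)\<^sup>2 = k\<^sup>2 * q * (x + b) \<longleftrightarrow> x \<in> {x1, x2, x3, x4}" by auto
  \<comment> \<open>Since the roots sum to 0, \<open>x1 + x3 = - k\<close> and
    \<open>x2 + x4 = k\<close>: the pairs are symmetric about \<open>- k/2\<close> and
    \<open>k/2\<close>, with half-widths \<open>m\<close> and \<open>n\<close>. The ordering of the
    roots becomes the triangle inequalities \<open>tri\<close> for \<open>k\<close>,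
    \<open>m\<close>, \<open>n\<close>.\<close>
  define m n where "m = (x3 - x1) / 2" and "n = (x4 - x2) / 2"
  have x: "x1 = - k/2 - m" "x3 = - k/2 + m" "x2 = k/2 - n" "x4 = k/2 + n"
    using sum F(1) by (auto simp: m_def n_def field_simps)
  have pos: "m > 0" "n > 0" and tri: "k < m + n" "m < k + n" "n < k + m"
    using less by (auto simp: x)
  have ka: "k * a = k\<^sup>2 / 4 + (m\<^sup>2 + n\<^sup>2) / 2"
    using F(2) by (simp add: x power2_eq_square field_simps)
  have "k * (k * q) = k * (n\<^sup>2 - m\<^sup>2)"
    using F(3) by (simp add: x power2_eq_square field_simps)
  then have kq: "k * q = n\<^sup>2 - m\<^sup>2" using k by simp
  have nm: "n > m"
  proof -
    have "n\<^sup>2 > m\<^sup>2" using kq k q by (metis diff_gt_0_iff_gt mult_pos_pos)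
    then show ?thesis using pos by (meson less_imp_le power_less_imp_less_base)
  qed
  have c2: "k * a - k\<^sup>2 / 2 = (m\<^sup>2 + n\<^sup>2) / 2 - k\<^sup>2 / 4"
    by (simp add: ka)
  have "k\<^sup>2 < (m + n)\<^sup>2" using tri k by (intro power_strict_mono) auto
  moreover have "(m + n)\<^sup>2 \<le> 2 * (m\<^sup>2 + n\<^sup>2)"
    using zero_le_power2[of "m - n"] by (simp add: power2_eq_square algebra_simps)
  ultimately show cpos: "k * a - k\<^sup>2 / 2 > 0" unfolding c2 by simp
  \<comment> \<open>\<open>x3\<close> and \<open>- x2\<close> may be negative, and then the
    comparison with the positive \<open>c\<close> is immediate; otherwise squares are
    compared.\<close>
  have lower: "u < c" if "0 \<le> u \<Longrightarrow> u\<^sup>2 < (m\<^sup>2 + n\<^sup>2) / 2 - k\<^sup>2 / 4" for u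
  proof (cases "0 \<le> u")
    case True then show ?thesis using that unfolding c_def c2 by (simp add: real_less_rsqrt)
  next
    case False then show ?thesis unfolding c_def
      using cpos by (smt (verit) real_sqrt_gt_zero)
  qed
  have upper: "c < u" if "0 < u" "(m\<^sup>2 + n\<^sup>2) / 2 - k\<^sup>2 / 4 < u\<^sup>2" for u
    using that unfolding c_def c2 by (simp add: real_less_lsqrt)
  \<comment> \<open>After expansion these squared triangle inequalities are exactly the comparisons
    of \<open>c\<^sup>2\<close> with the squares of \<open>x3\<close>, \<open>x4\<close>,
    \<open>x2\<close>, \<open>x1\<close>, in this order.\<close>
  have sq: "(m - k)\<^sup>2 < n\<^sup>2" "m\<^sup>2 < (k + n)\<^sup>2" "(n - k)\<^sup>2 < m\<^sup>2" "n\<^sup>2 < (k + m)\<^sup>2"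
    using power_strict_mono[of "\<bar>m - k\<bar>" n 2] power_strict_mono[of m "k + n" 2]
      power_strict_mono[of "\<bar>n - k\<bar>" m 2] power_strict_mono[of n "k + m" 2] tri pos k
    by (auto simp: abs_less_iff)
  have "x3 < c" by (rule lower) (use sq in \<open>simp add: x power2_eq_square field_simps\<close>)
  moreover have "c < x4" by (rule upper) (use sq k pos in \<open>simp_all add: x power2_eq_square field_simps\<close>)
  ultimately show "c \<in> {x3<..<x4}" by simp
  have "- x2 < c" by (rule lower) (use sq in \<open>simp add: x power2_eq_square field_simps\<close>)
  moreover have "c < - x1" by (rule upper) (use sq k pos in \<open>simp_all add: x power2_eq_square field_simps\<close>)
  ultimately show "- c \<in> {x1<..<x2}" by simp
  have "y x4 + y x2 = (k\<^sup>2 / 2 + 2 * n\<^sup>2 - 2 * (k * a)) / k"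
    using k by (simp add: y_def x power2_eq_square field_simps)
  also have "k\<^sup>2 / 2 + 2 * n\<^sup>2 - 2 * (k * a) = k * q" unfolding ka kq by (simp add: field_simps)
  finally show ys: "y x2 + y x4 = q" using k by simp
  have "x2\<^sup>2 - x3\<^sup>2 = (n - m) * (m + n - k)" "x1\<^sup>2 - x2\<^sup>2 = (m + n) * (k + m - n)"
       "x4\<^sup>2 - x1\<^sup>2 = (n - m) * (m + n + k)"
    by (simp_all add: x power2_eq_square field_simps)
  then have "x3\<^sup>2 < x2\<^sup>2" "x2\<^sup>2 < x1\<^sup>2" "x1\<^sup>2 < x4\<^sup>2"
    using nm tri pos k by (smt (verit) mult_pos_pos)+
  then show "y x3 < y x2" "y x2 < y x1" "y x1 < y x4"
    using k by (simp_all add: y_def divide_strict_right_mono)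
  \<comment> \<open>Here \<open>x1 * x3 = k\<^sup>2/4 - m\<^sup>2\<close> and
    \<open>x2 * x4 = k\<^sup>2/4 - n\<^sup>2\<close>. Both sides of the goal turn out to be
    \<open>(m\<^sup>2 + n\<^sup>2) / 2\<close>, the squared radius of the common circle.\<close>
  have "k\<^sup>2 * q * b = k\<^sup>2 * a\<^sup>2 - (k\<^sup>2/4 - m\<^sup>2) * (k\<^sup>2/4 - n\<^sup>2)"
    using F(4) by (simp add: x power2_eq_square field_simps)
  also have "k\<^sup>2 * a\<^sup>2 = (k\<^sup>2 / 4 + (m\<^sup>2 + n\<^sup>2) / 2)\<^sup>2"
    unfolding ka[symmetric] by (simp add: power_mult_distrib)
  finally have "k\<^sup>2 * (q * b) = k\<^sup>2 * (m\<^sup>2 + n\<^sup>2) / 2 + (n\<^sup>2 - m\<^sup>2)\<^sup>2 / 4"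
    by (simp add: power2_eq_square field_simps)
  also have "\<dots> = k\<^sup>2 * (k * a - k\<^sup>2 / 4 + q\<^sup>2 / 4)"
    unfolding kq[symmetric] ka by (simp add: power2_eq_square field_simps)
  finally show "k * a - k\<^sup>2 / 4 = q * b - q\<^sup>2 / 4" using k by simp
qed

section \<open>Parabolas with the coordinate axes as axes\<close>

text \<open>The coordinates \<open>i\<close> and \<open>j\<close> are parameters so that two
  parabolas with perpendicular axes belong to one family and the contact argument is carried out
  only once.\<close>

definition axis_parabola :: "2 \<Rightarrow> 2 \<Rightarrow> real \<Rightarrow> real \<Rightarrow> (real^2) set" where
  "axis_parabola i j k a = {z. (z $ i)\<^sup>2 = k * (z $ j + a)}"

definition axis_region :: "2 \<Rightarrow> 2 \<Rightarrow> real \<Rightarrow> real \<Rightarrow> (real^2) set" where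
  "axis_region i j k a = {z. (z $ i)\<^sup>2 \<le> k * (z $ j + a)}"

lemma
  fixes i j :: 2 and x y :: "real^2"
  assumes "i \<noteq> j"
  shows inner_two: "x \<bullet> y = x $ i * y $ i + x $ j * y $ j"
    and dist_two: "(dist x y)\<^sup>2 = (x $ i - y $ i)\<^sup>2 + (x $ j - y $ j)\<^sup>2"
    and eq_two: "x = y \<longleftrightarrow> x $ i = y $ i \<and> x $ j = y $ j"
proof -
  have ij: "i = 1 \<and> j = 2 \<or> i = 2 \<and> j = 1" using assms by (metis exhaust_2)
  then show *: "x \<bullet> y = x $ i * y $ i + x $ j * y $ j" for x y :: "real^2"
    by (auto simp: inner_vec_def sum_2)
  show "(dist x y)\<^sup>2 = (x $ i - y $ i)\<^sup>2 + (x $ j - y $ j)\<^sup>2"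
    unfolding dist_norm power2_norm_eq_inner * by (simp add: power2_eq_square)
  show "x = y \<longleftrightarrow> x $ i = y $ i \<and> x $ j = y $ j"
    using ij by (auto simp: vec_eq_iff forall_2)
qed

lemma axis_parabola_is_parabola:
  assumes "i \<noteq> j" "k > 0"
  obtains F d where "is_line d" "F \<notin> d" "parabola F d = axis_parabola i j k a"
    "parabola_region F d = axis_region i j k a"
proof -
  \<comment> \<open>The vertex has \<open>j\<close>-coordinate \<open>- a\<close> and the focal
    length is \<open>k / 4\<close>: focus and directrix lie at this distance on either side of the
    vertex.\<close>
  define F :: "real^2" where "F = (\<chi> l. if l = i then 0 else k / 4 - a)"
  define d :: "(real^2) set" where "d = {x. axis j 1 \<bullet> x = - k / 4 - a}"
  have F: "F $ i = 0" "F $ j = k / 4 - a" using assms by (auto simp: F_def)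
  have "is_line d"
    unfolding is_line_iff d_def by (intro exI[of _ "axis j 1"] exI) (auto simp: axis_eq_0_iff)
  moreover have "F \<notin> d" using assms F by (simp add: d_def inner_axis')
  moreover have infd: "infdist x d = \<bar>x $ j + k / 4 + a\<bar>" for x
    unfolding d_def by (subst infdist_hyperplane) (simp_all add: axis_eq_0_iff inner_axis' algebra_simps)
  have diff: "(dist x F)\<^sup>2 - (infdist x d)\<^sup>2 = (x $ i)\<^sup>2 - k * (x $ j + a)" for x
    unfolding infd dist_two[OF assms(1)] F by (simp add: power2_eq_square field_simps)
  have "dist x F \<le> infdist x d \<longleftrightarrow> (x $ i)\<^sup>2 \<le> k * (x $ j + a)" for x
  proof -
    have "dist x F \<le> infdist x d \<longleftrightarrow> (dist x F)\<^sup>2 \<le> (infdist x d)\<^sup>2"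
      using abs_le_square_iff[of "dist x F" "infdist x d"] by (simp add: infdist_nonneg)
    also have "\<dots> \<longleftrightarrow> (x $ i)\<^sup>2 \<le> k * (x $ j + a)" using diff[of x] by (intro iffI; linarith)
    finally show ?thesis .
  qed
  moreover have "dist x F = infdist x d \<longleftrightarrow> (x $ i)\<^sup>2 = k * (x $ j + a)" for x
    using diff[of x] power2_eq_iff_nonneg[of "dist x F" "infdist x d"] by (auto simp: infdist_nonneg)
  ultimately show ?thesis
    by (intro that[of d F]) (auto simp: parabola_def parabola_region_def axis_parabola_def axis_region_def)
qed

lemma closed_axis_region: "closed (axis_region i j k a)"
  unfolding axis_region_def by (intro closed_Collect_le continuous_intros)

text \<open>A shift against the axis direction, however small, takes a point of the parabola out of
  its region, so such a point is never interior to the closed intersection.\<close>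

lemma axis_parabola_Int_frontier:
  assumes "i \<noteq> j" "k > 0" "closed R"
  shows "axis_parabola i j k a \<inter> frontier (axis_region i j k a \<inter> R) = axis_parabola i j k a \<inter> R"
proof -
  let ?Q = "axis_region i j k a \<inter> R"
  have "closed ?Q" using assms(3) closed_axis_region by blast
  moreover have "z \<notin> interior ?Q" if z: "z \<in> axis_parabola i j k a" for z
  proof
    assume "z \<in> interior ?Q"
    then obtain e where e: "e > 0" "cball z e \<subseteq> ?Q" by (meson mem_interior_cball)
    have "z - axis j e \<in> cball z e" using e by (simp add: dist_norm norm_eq_sqrt_inner inner_axis_axis)
    then have "z - axis j e \<in> axis_region i j k a" using e by blast
    moreover have "k * e > 0" using e assms by simp
    ultimately show False
      using z assms by (simp add: axis_parabola_def axis_region_def axis_def algebra_simps)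
  qed
  ultimately show ?thesis
    by (auto simp: frontier_def closure_closed axis_parabola_def axis_region_def)
qed

text \<open>
  At its contact points \<open>p\<close> the circle around the origin has the tangent \<open>p \<bullet> x = p \<bullet> p\<close>.
  Only the arc containing a given point of the component has to be inside it; the
  components themselves are never computed.
\<close>
lemma side_touches_circle:
  fixes i j :: 2 and k a q b x1 x2 x3 x4 :: real
  defines "C \<equiv> axis_parabola i j k a" and "D \<equiv> axis_parabola j i q b"
    and "Q \<equiv> axis_region i j k a \<inter> axis_region j i q b"
  assumes ij: "i \<noteq> j" and k: "k > 0" and q: "q > 0" and less: "x1 < x2" "x2 < x3" "x3 < x4"
    and root: "\<forall>x\<in>{x1, x2, x3, x4}. (x\<^sup>2 - k * a)\<^sup>2 = k\<^sup>2 * q * (x + b)"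
    and sum: "x2 + x4 = k"
    and s: "s \<in> components (C \<inter> frontier Q)"
  shows "\<exists>p\<in>s - C \<inter> D. \<exists>L. tangent_line s p L \<and> tangent_line (sphere 0 (sqrt (k * a - k\<^sup>2 / 4))) p L"
proof -
  note contact = double_contact[OF k q less root sum]
  define c where "c = sqrt (k * a - k\<^sup>2 / 2)"
  define \<gamma> :: "real \<Rightarrow> real^2" where "\<gamma> x = (\<chi> l. if l = i then x else x\<^sup>2 / k - a)" for x
  have \<gamma>: "\<gamma> x $ i = x" "\<gamma> x $ j = x\<^sup>2 / k - a" for x using ij by (auto simp: \<gamma>_def)
  have "\<gamma> x \<in> C" for x using k by (simp add: C_def axis_parabola_def \<gamma>)
  moreover have "z = \<gamma> (z $ i)" if "z \<in> C" for z
    using k that by (simp add: C_def axis_parabola_def eq_two[OF ij] \<gamma>)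
  ultimately have C: "C = range \<gamma>" by blast
  have CQ: "C \<inter> frontier Q = C \<inter> axis_region j i q b"
    unfolding C_def Q_def by (intro axis_parabola_Int_frontier ij k closed_axis_region)
  have sq: "(x\<^sup>2 / k - a)\<^sup>2 = (x\<^sup>2 - k * a)\<^sup>2 / k\<^sup>2" for x
    using k by (simp add: field_simps flip: power_divide)
  have mem_region: "\<gamma> x \<in> axis_region j i q b \<longleftrightarrow> x \<in> {x1..x2} \<union> {x3..x4}" for x
  proof -
    have "\<gamma> x \<in> axis_region j i q b \<longleftrightarrow> (x\<^sup>2 - k * a)\<^sup>2 \<le> k\<^sup>2 * q * (x + b)"
      using k by (simp add: axis_region_def \<gamma> sq divide_le_eq mult_ac)
    also note contact(2)
    finally show ?thesis .
  qed
  have mem_D: "\<gamma> x \<in> D \<longleftrightarrow> x \<in> {x1, x2, x3, x4}" for x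
  proof -
    have "\<gamma> x \<in> D \<longleftrightarrow> (x\<^sup>2 - k * a)\<^sup>2 = k\<^sup>2 * q * (x + b)"
      using k by (simp add: D_def axis_parabola_def \<gamma> sq divide_eq_eq mult_ac)
    also note contact(3)
    finally show ?thesis .
  qed
  obtain z where "z \<in> s" using s in_components_nonempty by blast
  then obtain x where z: "z = \<gamma> x" "\<gamma> x \<in> axis_region j i q b"
    using in_components_subset[OF s] C unfolding CQ by auto
  \<comment> \<open>\<open>{u..v}\<close> is the one of the two parameter intervals that contains
    \<open>x\<close>, and \<open>t\<close> is the contact parameter inside it. As \<open>t\<close>
    is not a root, the contact point is not a vertex.\<close>
  obtain u v t where uv: "u < t" "t < v" "x \<in> {u..v}" "{u..v} \<subseteq> {x1..x2} \<union> {x3..x4}"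
    and t: "t = c \<or> t = - c" "t \<notin> {x1, x2, x3, x4}"
  proof (cases "x \<in> {x1..x2}")
    case True
    with contact(5) less show ?thesis by (intro that[of x1 "-c" x2]) (auto simp: c_def)
  next
    case False
    with contact(4) z less show ?thesis unfolding mem_region by (intro that[of x3 c x4]) (auto simp: c_def)
  qed
  have arc: "\<gamma> ` {u..v} \<subseteq> s"
  proof (rule components_maximal[OF s])
    have "continuous_on {u..v} (\<lambda>x. if l = i then x else x\<^sup>2 / k - a)" for l
      using k by (cases "l = i") (auto intro!: continuous_intros)
    then have "continuous_on {u..v} \<gamma>"
      unfolding \<gamma>_def by (intro continuous_on_vec_lambda)
    then show "connected (\<gamma> ` {u..v})" by (intro connected_continuous_image) auto
    show "\<gamma> ` {u..v} \<subseteq> C \<inter> frontier Q" unfolding CQ using uv(4) mem_region by (auto simp: C)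
    show "s \<inter> \<gamma> ` {u..v} \<noteq> {}" using \<open>z \<in> s\<close> z uv by blast
  qed
  define p where "p = \<gamma> t"
  have "t\<^sup>2 = k * a - k\<^sup>2 / 2" using t(1) contact(1) by (auto simp: c_def)
  then have p: "p $ i = t" "p $ j = - k / 2" and t2: "t\<^sup>2 = k * a - k\<^sup>2 / 2"
    using k by (auto simp: p_def \<gamma> power2_eq_square field_simps)
  have "p \<in> s" using arc uv unfolding p_def by auto
  moreover have "p \<notin> D" unfolding p_def mem_D using t by blast
  moreover have "tangent_line s p {x. p \<bullet> x = p \<bullet> p}"
  proof (rule tangent_line_hyperplane[where K = "1/2"])
    show "p \<noteq> 0" using p k by auto
    \<comment> \<open>A connected set with more than one point has no isolated points.\<close>
    show "p islimpt s"
    proof (rule connected_imp_perfect[OF in_components_connected[OF s] \<open>p \<in> s\<close>])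
      have "\<gamma> u \<in> s" using arc uv by auto
      moreover have "\<gamma> u \<noteq> p" using p uv \<gamma> by auto
      ultimately show "s \<noteq> {b}" for b using \<open>p \<in> s\<close> by auto
    qed
    \<comment> \<open>With \<open>p $ j = - k / 2\<close> and this value of
      \<open>t\<^sup>2\<close>, the expression \<open>p \<bullet> (x - p)\<close> becomes minus half
      a perfect square on the parabola. Hence the perpendicular to the radius at \<open>p\<close> is
      tangent to the side as well.\<close>
    show "\<bar>p \<bullet> (x - p)\<bar> \<le> 1/2 * (dist x p)\<^sup>2" if "x \<in> s" for x
    proof -
      have "x \<in> C" using that in_components_subset[OF s] by blast
      then have "k * (x $ j) = (x $ i)\<^sup>2 - k * a" by (simp add: C_def axis_parabola_def algebra_simps)
      then have "p \<bullet> (x - p) = - (x $ i - t)\<^sup>2 / 2"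
        using t2 by (simp add: inner_two[OF ij] p power2_eq_square algebra_simps)
      then show ?thesis by (simp add: dist_two[OF ij] p)
    qed
  qed (fact \<open>p \<in> s\<close>)
  moreover have "tangent_line (sphere 0 (sqrt (k * a - k\<^sup>2 / 4))) p {x. p \<bullet> x = p \<bullet> p}"
  proof -
    have "(norm p)\<^sup>2 = k * a - k\<^sup>2 / 4"
      unfolding power2_norm_eq_inner inner_two[OF ij] p using t2 by (simp add: power2_eq_square)
    then have r: "sqrt (k * a - k\<^sup>2 / 4) = norm p" by (metis norm_ge_zero real_sqrt_unique)
    have "p \<noteq> 0" using p k by auto
    show ?thesis unfolding r
    proof (rule tangent_line_hyperplane[where K = "1/2"])
      show "p islimpt sphere 0 (norm p)"
      proof (rule connected_imp_perfect)
        show "connected (sphere (0::real^2) (norm p))" by (simp add: connected_sphere_eq)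
        have "(- p) $ j \<noteq> p $ j" using p k by simp
        then have "- p \<noteq> p" by metis
        moreover have "- p \<in> sphere 0 (norm p)" by simp
        ultimately show "sphere 0 (norm p) \<noteq> {b}" for b :: "real^2" by (metis dist_0_norm mem_sphere singletonD)
      qed simp
      show "\<bar>p \<bullet> (x - p)\<bar> \<le> 1/2 * (dist x p)\<^sup>2" if "x \<in> sphere 0 (norm p)" for x
      proof -
        have "x \<bullet> x = p \<bullet> p" using that by (simp add: norm_eq)
        then have "(dist x p)\<^sup>2 = - 2 * (p \<bullet> (x - p))"
          by (simp add: dist_norm power2_norm_eq_inner inner_diff_left inner_diff_right inner_commute)
        then show ?thesis using zero_le_power2[of "dist x p"] by linarith
      qed
    qed (use \<open>p \<noteq> 0\<close> in auto)
  qed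
  ultimately show ?thesis by blast
qed

text \<open>The second parabola is treated by exchanging the coordinates, with the ordinates of the
  vertices as roots; the equality of the two radii in \<open>double_contact\<close> makes both
  contacts belong to one circle.\<close>

lemma circumscribed_quadrilateral:
  fixes k a q b x1 x2 x3 x4 :: real
  defines "P1 \<equiv> axis_parabola 1 2 k a" and "P2 \<equiv> axis_parabola 2 1 q b"
    and "Q \<equiv> axis_region 1 2 k a \<inter> axis_region 2 1 q b"
  defines "S \<equiv> components (P1 \<inter> frontier Q) \<union> components (P2 \<inter> frontier Q)"
  assumes k: "k > 0" and q: "q > 0" and less: "x1 < x2" "x2 < x3" "x3 < x4"
    and root: "\<forall>x\<in>{x1, x2, x3, x4}. (x\<^sup>2 - k * a)\<^sup>2 = k\<^sup>2 * q * (x + b)"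
    and sum: "x2 + x4 = k"
    and card: "card (P1 \<inter> P2) = 4"
  shows "parabolic_quadrilateral Q (P1 \<inter> P2) S" "inscribed (P1 \<inter> P2)" "circumscribed (P1 \<inter> P2) S"
proof -
  have ne: "(1::2) \<noteq> 2" "(2::2) \<noteq> 1" by auto
  obtain F1 d1 F2 d2 where
    F1: "is_line d1" "F1 \<notin> d1" "parabola F1 d1 = P1" "parabola_region F1 d1 = axis_region 1 2 k a" and
    F2: "is_line d2" "F2 \<notin> d2" "parabola F2 d2 = P2" "parabola_region F2 d2 = axis_region 2 1 q b"
    using axis_parabola_is_parabola[OF ne(1) k, of a] axis_parabola_is_parabola[OF ne(2) q, of b]
    unfolding P1_def P2_def by metis
  show "parabolic_quadrilateral Q (P1 \<inter> P2) S"
    unfolding parabolic_quadrilateral_def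
    by (intro exI[of _ F1] exI[of _ d1] exI[of _ F2] exI[of _ d2])
       (simp add: F1 F2 card Q_def S_def)

  note contact = double_contact[OF k q less root sum]
  define y where "y x = x\<^sup>2 / k - a" for x
  \<comment> \<open>A vertex satisfies \<open>k * (y + a) = x\<^sup>2\<close> and
    \<open>y\<^sup>2 = q * (x + b)\<close>; eliminating \<open>x\<close> instead of \<open>y\<close>
    gives the quartic of the ordinates.\<close>
  have root': "((y x)\<^sup>2 - q * b)\<^sup>2 = q\<^sup>2 * k * (y x + a)" if "x \<in> {x1, x2, x3, x4}" for x
  proof -
    have ky: "k * (y x + a) = x\<^sup>2" using k by (simp add: y_def)
    have "k\<^sup>2 * (y x)\<^sup>2 = (x\<^sup>2 - k * a)\<^sup>2"
      using k by (simp add: y_def field_simps flip: power_mult_distrib)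
    also have "\<dots> = k\<^sup>2 * (q * (x + b))" using root that by auto
    finally have "(y x)\<^sup>2 = q * (x + b)" using k by simp
    then have "((y x)\<^sup>2 - q * b)\<^sup>2 = q\<^sup>2 * (k * (y x + a))"
      unfolding ky by (simp add: power2_eq_square algebra_simps)
    then show ?thesis by (simp add: mult.assoc)
  qed
  have less': "y x3 < y x2" "y x2 < y x1" "y x1 < y x4" and sum': "y x2 + y x4 = q"
    and radius: "k * a - k\<^sup>2 / 4 = q * b - q\<^sup>2 / 4"
    using contact(6-10) by (simp_all add: y_def)
  have root'': "\<forall>z\<in>{y x3, y x2, y x1, y x4}. (z\<^sup>2 - q * b)\<^sup>2 = q\<^sup>2 * k * (z + a)"
    using root' by auto
  have pos: "k * a - k\<^sup>2 / 2 > 0" "q * b - q\<^sup>2 / 2 > 0"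
    by (fact contact(1), rule double_contact(1)[OF q k less' root'' sum'])

  show "inscribed (P1 \<inter> P2)"
  proof -
    \<comment> \<open>The sum of the two equations is
      \<open>x\<^sup>2 + y\<^sup>2 - q * x - k * y = k * a + q * b\<close>. Completing squares gives
      the centre \<open>(q/2, k/2)\<close> and the squared radius \<open>r\<close>.\<close>
    define r where "r = k * a + q * b + k\<^sup>2 / 4 + q\<^sup>2 / 4"
    have "k\<^sup>2 > 0" "q\<^sup>2 > 0" using k q by auto
    then have "r > 0" using pos unfolding r_def by linarith
    moreover have "dist (vector [q/2, k/2]) z = sqrt r" if "z \<in> P1 \<inter> P2" for z
    proof -
      have "(dist (vector [q/2, k/2]) z)\<^sup>2 = r"
        unfolding dist_two[OF ne(1)] r_def
        using that by (simp add: P1_def P2_def axis_parabola_def power2_eq_square algebra_simps)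
      then show ?thesis by (metis real_sqrt_unique zero_le_dist)
    qed
    ultimately show ?thesis
      unfolding inscribed_def by (intro exI[of _ "vector [q/2, k/2]"] exI[of _ "sqrt r"]) auto
  qed

  show "circumscribed (P1 \<inter> P2) S"
    unfolding circumscribed_def
  proof (intro exI conjI ballI)
    have "k\<^sup>2 > 0" using k by auto
    then have "k * a - k\<^sup>2 / 4 > 0" using pos(1) by linarith
    then show "sqrt (k * a - k\<^sup>2 / 4) > 0" by simp
    fix s assume "s \<in> S"
    then consider "s \<in> components (P1 \<inter> frontier Q)" | "s \<in> components (P2 \<inter> frontier Q)"
      unfolding S_def by blast
    then show "\<exists>p\<in>s - P1 \<inter> P2. \<exists>L. tangent_line s p L \<and>
       tangent_line (sphere 0 (sqrt (k * a - k\<^sup>2 / 4))) p L"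
    proof cases
      case 1 then show ?thesis
        using side_touches_circle[OF ne(1) k q less root sum] by (simp add: P1_def P2_def Q_def)
    next
      case 2 then show ?thesis
        using side_touches_circle[OF ne(2) q k less' root'' sum', of s] radius
        by (simp add: P1_def P2_def Q_def Int_commute)
    qed
  qed
qed

section \<open>From focus and directrix to a quadratic equation\<close>

lemma parabola_quadratic_equation:
  assumes "is_line d" "F \<notin> d"
  obtains m1 m2 c \<kappa> h where "m1 \<noteq> 0 \<or> m2 \<noteq> 0" "\<kappa> \<noteq> 0"
    "parabola F d = {z. (m1 * z $ 1 + m2 * z $ 2 - c)\<^sup>2 = \<kappa> * (m1 * z $ 2 - m2 * z $ 1) + h}"
    "parabola_region F d = {z. (m1 * z $ 1 + m2 * z $ 2 - c)\<^sup>2 \<le> \<kappa> * (m1 * z $ 2 - m2 * z $ 1) + h}"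
proof -
  have ne: "(1::2) \<noteq> 2" by auto
  obtain n b where n: "n \<noteq> 0" and d: "d = {x. n \<bullet> x = b}" using assms by (auto simp: is_line_iff)
  \<comment> \<open>\<open>(m1, m2)\<close> is \<open>n\<close> turned by a right angle, a direction
    of the directrix. \<open>\<delta>\<close> is nonzero because the focus is off the
    directrix.\<close>
  define m1 m2 \<delta> where "m1 = - n $ 2" and "m2 = n $ 1" and "\<delta> = n \<bullet> F - b"
  define c h where "c = m1 * F $ 1 + m2 * F $ 2" and "h = \<delta>\<^sup>2 - 2 * \<delta> * (n \<bullet> F)"
  have m: "m1 \<noteq> 0 \<or> m2 \<noteq> 0" using n by (auto simp: m1_def m2_def eq_two[OF ne])
  have \<delta>: "\<delta> \<noteq> 0" using assms(2) d by (simp add: \<delta>_def)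
  have infd: "norm n * infdist x d = \<bar>n \<bullet> x - b\<bar>" for x
    unfolding d using n by (simp add: infdist_hyperplane)
  \<comment> \<open>The first square splits into the squared products of \<open>x - F\<close> with
    \<open>n\<close> and with \<open>(m1, m2)\<close>. The quadratic part of the former cancels
    against the directrix term, leaving a linear remainder.\<close>
  have eq: "(norm n * dist x F)\<^sup>2 - (norm n * infdist x d)\<^sup>2
      = (m1 * x $ 1 + m2 * x $ 2 - c)\<^sup>2 - (- 2 * \<delta> * (m1 * x $ 2 - m2 * x $ 1) + h)" for x
    unfolding infd power_mult_distrib power2_norm_eq_inner dist_two[OF ne]
    by (simp add: inner_two[OF ne] m1_def m2_def c_def h_def \<delta>_def power2_eq_square algebra_simps)
  have "dist x F \<le> infdist x d \<longleftrightarrow> (norm n * dist x F)\<^sup>2 \<le> (norm n * infdist x d)\<^sup>2" for x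
    using abs_le_square_iff[of "norm n * dist x F" "norm n * infdist x d"] n
    by (simp add: infdist_nonneg abs_mult)
  then have le: "dist x F \<le> infdist x d \<longleftrightarrow>
      (m1 * x $ 1 + m2 * x $ 2 - c)\<^sup>2 \<le> - 2 * \<delta> * (m1 * x $ 2 - m2 * x $ 1) + h" for x
    using eq[of x] by (smt (verit, best))
  have "dist x F = infdist x d \<longleftrightarrow> (norm n * dist x F)\<^sup>2 = (norm n * infdist x d)\<^sup>2" for x
    using power2_eq_iff_nonneg[of "norm n * dist x F" "norm n * infdist x d"] n
    by (simp add: infdist_nonneg)
  then have "dist x F = infdist x d \<longleftrightarrow>
      (m1 * x $ 1 + m2 * x $ 2 - c)\<^sup>2 = - 2 * \<delta> * (m1 * x $ 2 - m2 * x $ 1) + h" for x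
    using eq[of x] by (smt (verit, best))
  with le show ?thesis
    using m \<delta> by (intro that[of m1 m2 "- 2 * \<delta>" c h]) (auto simp: parabola_def parabola_region_def)
qed

section \<open>Reduction to coordinate axes\<close>

text \<open>
  Eliminating the coordinate along the common axis leaves a quadratic equation with four
  solutions, so it is trivial and the parabolas coincide; the junk value \<open>card = 0\<close> of
  an infinite set is then different from \<open>4\<close>.
\<close>
lemma common_direction_parabolas:
  fixes m1 m2 p1 p2 c c' \<kappa> \<kappa>' h h' :: real
  defines "P \<equiv> {z :: real^2. (m1 * z $ 1 + m2 * z $ 2 - c)\<^sup>2 = \<kappa> * (m1 * z $ 2 - m2 * z $ 1) + h}"
    and "P' \<equiv> {z :: real^2. (p1 * z $ 1 + p2 * z $ 2 - c')\<^sup>2 = \<kappa>' * (p1 * z $ 2 - p2 * z $ 1) + h'}"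
  assumes m: "m1 \<noteq> 0 \<or> m2 \<noteq> 0" and \<kappa>: "\<kappa> \<noteq> 0"
    and det: "m1 * p2 = m2 * p1"
  shows "card (P \<inter> P') \<noteq> 4"
proof
  assume card: "card (P \<inter> P') = 4"
  have ne: "(1::2) \<noteq> 2" by auto
  define N where "N = m1\<^sup>2 + m2\<^sup>2"
  define \<mu> where "\<mu> = (m1 * p1 + m2 * p2) / N"
  have N: "N > 0" using m by (auto simp: N_def sum_power2_gt_zero_iff)
  have "N * p1 = (m1 * p1 + m2 * p2) * m1" "N * p2 = (m1 * p1 + m2 * p2) * m2"
    unfolding N_def using det by algebra+
  then have p1: "p1 = \<mu> * m1" and p2: "p2 = \<mu> * m2"
    using N by (simp_all add: \<mu>_def field_simps)
  \<comment> \<open>\<open>u\<close> and \<open>w\<close> are orthogonal coordinates across and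
    along the common axis, \<open>g\<close> inverts them, and \<open>f\<close> parametrises the
    first parabola by \<open>u\<close>.\<close>
  define u w where "u z = m1 * z $ 1 + m2 * z $ 2" and "w z = m1 * z $ 2 - m2 * z $ 1" for z :: "real^2"
  define g :: "real \<Rightarrow> real \<Rightarrow> real^2"
    where "g t s = vector [(m1 * t - m2 * s) / N, (m2 * t + m1 * s) / N]" for t s
  define f where "f t = g t (((t - c)\<^sup>2 - h) / \<kappa>)" for t
  have "u (g t s) = t" "w (g t s) = s" for t s
  proof -
    have "m1 * (m1 * t - m2 * s) + m2 * (m2 * t + m1 * s) = N * t"
      "m1 * (m2 * t + m1 * s) - m2 * (m1 * t - m2 * s) = N * s"
      by (simp_all add: N_def power2_eq_square algebra_simps)
    then have "(m1 * (m1 * t - m2 * s) + m2 * (m2 * t + m1 * s)) / N = t"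
      "(m1 * (m2 * t + m1 * s) - m2 * (m1 * t - m2 * s)) / N = s"
      using N by simp_all
    then show "u (g t s) = t" "w (g t s) = s"
      by (simp_all only: u_def w_def g_def vector_2 times_divide_eq_right
          flip: add_divide_distrib diff_divide_distrib)
  qed
  then have uf: "u (f t) = t" and wf: "w (f t) = ((t - c)\<^sup>2 - h) / \<kappa>" for t
    by (simp_all add: f_def)
  have P: "z \<in> P \<longleftrightarrow> (u z - c)\<^sup>2 = \<kappa> * w z + h" for z by (simp add: P_def u_def w_def)
  have P': "z \<in> P' \<longleftrightarrow> (\<mu> * u z - c')\<^sup>2 = \<kappa>' * \<mu> * w z + h'" for z
    by (simp add: P'_def u_def w_def p1 p2 algebra_simps)
  have fP: "f t \<in> P" for t using \<kappa> by (simp add: P uf wf)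
  have inj: "inj_on u P"
  proof (rule inj_onI)
    fix x y assume "x \<in> P" "y \<in> P" and u: "u x = u y"
    then have w: "w x = w y" using \<kappa> by (simp add: P)
    have "N * (z $ 1) = m1 * u z - m2 * w z" "N * (z $ 2) = m2 * u z + m1 * w z" for z
      by (simp_all add: N_def u_def w_def power2_eq_square algebra_simps)
    then have "N * (x $ 1) = N * (y $ 1)" "N * (x $ 2) = N * (y $ 2)" using u w by auto
    then show "x = y" using N by (simp add: eq_two[OF ne])
  qed
  \<comment> \<open>Along \<open>f\<close>, the second equation multiplied by
    \<open>\<kappa>\<close> and moved to one side is this polynomial of degree at most 2.\<close>
  define r where "r = [:\<kappa>' * \<mu> * (c\<^sup>2 - h) + \<kappa> * (h' - c'\<^sup>2), 2 * \<kappa> * \<mu> * c' - 2 * \<kappa>' * \<mu> * c,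
    \<kappa>' * \<mu> - \<kappa> * \<mu>\<^sup>2:]"
  have r: "poly r t = \<kappa>' * \<mu> * ((t - c)\<^sup>2 - h) + \<kappa> * h' - \<kappa> * (\<mu> * t - c')\<^sup>2" for t
    by (simp add: r_def power2_eq_square algebra_simps)
  have r': "f t \<in> P' \<longleftrightarrow> poly r t = 0" for t
    unfolding P' uf wf r using \<kappa> by (auto simp: field_simps)
  have "r = 0"
  proof (rule poly_eqI_degree[where A = "u ` (P \<inter> P')"])
    have "card (u ` (P \<inter> P')) = 4"
      using card card_image[OF inj_on_subset[OF inj]] by (metis Int_lower1)
    then show "degree r < card (u ` (P \<inter> P'))" "degree 0 < card (u ` (P \<inter> P'))"
      by (auto simp: r_def)
    fix t assume "t \<in> u ` (P \<inter> P')"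
    then obtain z where z: "z \<in> P" "z \<in> P'" "t = u z" by auto
    then have "f t = z" using inj fP uf by (metis inj_onD)
    then show "poly r t = poly 0 t" using r'[of t] z by simp
  qed
  then have "range f \<subseteq> P \<inter> P'" using fP r' by auto
  moreover have "finite (P \<inter> P')" using card by (metis card.infinite zero_neq_numeral)
  ultimately have "finite (range f)" by (rule finite_subset)
  moreover have "inj f" using uf by (metis injI)
  ultimately show False using finite_imageD infinite_UNIV_char_0 by blast
qed

text \<open>The two squared linear forms are independent and serve as new coordinates, up to shifts
  and signs. Since \<open>G\<close> and \<open>G'\<close> keep their values, the equations and the
  inequalities are transported together.\<close>

lemma simultaneous_axis_form:
  fixes m1 m2 p1 p2 c c' \<kappa> \<kappa>' h h' :: real
  defines "G \<equiv> \<lambda>z :: real^2. (m1 * z $ 1 + m2 * z $ 2 - c)\<^sup>2 - (\<kappa> * (m1 * z $ 2 - m2 * z $ 1) + h)"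
    and "G' \<equiv> \<lambda>z :: real^2. (p1 * z $ 1 + p2 * z $ 2 - c')\<^sup>2 - (\<kappa>' * (p1 * z $ 2 - p2 * z $ 1) + h')"
  assumes \<kappa>: "\<kappa> \<noteq> 0" "\<kappa>' \<noteq> 0" and det: "m1 * p2 \<noteq> m2 * p1"
  obtains f k a q b where "invertible_affine_map f" "k > 0" "q > 0"
    "\<And>z. G z = (f z $ 1)\<^sup>2 - k * (f z $ 2 + a)" "\<And>z. G' z = (f z $ 2)\<^sup>2 - q * (f z $ 1 + b)"
proof -
  define D where "D = m1 * p2 - m2 * p1"
  have D: "D \<noteq> 0" using det by (simp add: D_def)
  define E where "E = m1 * p1 + m2 * p2"
  define u v where "u z = m1 * z $ 1 + m2 * z $ 2" and "v z = p1 * z $ 1 + p2 * z $ 2" for z :: "real^2"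
  define k0 q0 where "k0 = \<kappa> * (m1\<^sup>2 + m2\<^sup>2) / D" and "q0 = - \<kappa>' * (p1\<^sup>2 + p2\<^sup>2) / D"
  have "m1\<^sup>2 + m2\<^sup>2 \<noteq> 0" "p1\<^sup>2 + p2\<^sup>2 \<noteq> 0" using det by auto
  then have kq: "k0 \<noteq> 0" "q0 \<noteq> 0" using \<kappa> D by (auto simp: k0_def q0_def)
  \<comment> \<open>In the coordinates \<open>u\<close>, \<open>v\<close> each linear term also
    involves the squared coordinate; these shifts absorb that part by completing the square.\<close>
  define c1 c2 where "c1 = c - \<kappa> * E / (2 * D)" and "c2 = c' + \<kappa>' * E / (2 * D)"
  define a0 b0 where "a0 = (h + c1\<^sup>2 - c\<^sup>2) / k0" and "b0 = (h' + c2\<^sup>2 - c'\<^sup>2) / q0"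
  have "D * (m1 * z $ 2 - m2 * z $ 1) = (m1\<^sup>2 + m2\<^sup>2) * v z - E * u z"
    "D * (p1 * z $ 2 - p2 * z $ 1) = E * v z - (p1\<^sup>2 + p2\<^sup>2) * u z" for z
    by (simp_all add: D_def E_def u_def v_def power2_eq_square algebra_simps)
  then have *: "m1 * z $ 2 - m2 * z $ 1 = ((m1\<^sup>2 + m2\<^sup>2) * v z - E * u z) / D"
    "p1 * z $ 2 - p2 * z $ 1 = (E * v z - (p1\<^sup>2 + p2\<^sup>2) * u z) / D" for z
    using D by (simp_all add: field_simps)
  have k0: "\<kappa> * (((m1\<^sup>2 + m2\<^sup>2) * V - E * U) / D) = k0 * V - 2 * (c - c1) * U" for U V
    using D by (simp add: k0_def c1_def field_simps)
  have q0: "\<kappa>' * ((E * V - (p1\<^sup>2 + p2\<^sup>2) * U) / D) = q0 * U - 2 * (c' - c2) * V" for U V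
    using D by (simp add: q0_def c2_def field_simps)
  have G: "G z = (u z - c1)\<^sup>2 - k0 * (v z + a0)" for z
  proof -
    have "k0 * a0 = h + c1\<^sup>2 - c\<^sup>2" using kq by (simp add: a0_def)
    then show ?thesis unfolding G_def * k0 u_def[symmetric]
      by (simp add: power2_eq_square algebra_simps)
  qed
  have G': "G' z = (v z - c2)\<^sup>2 - q0 * (u z + b0)" for z
  proof -
    have "q0 * b0 = h' + c2\<^sup>2 - c'\<^sup>2" using kq by (simp add: b0_def)
    then show ?thesis unfolding G'_def * q0 v_def[symmetric]
      by (simp add: power2_eq_square algebra_simps)
  qed
  \<comment> \<open>Reflecting the coordinates makes both parameters positive and leaves the squares
    unchanged.\<close>
  define \<sigma> \<tau> where "\<sigma> = sgn q0" and "\<tau> = sgn k0"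
  have st: "\<sigma>\<^sup>2 = 1" "\<tau>\<^sup>2 = 1" "\<sigma> \<noteq> 0" "\<tau> \<noteq> 0" "\<bar>q0\<bar> * \<sigma> = q0" "\<bar>k0\<bar> * \<tau> = k0"
    using kq by (auto simp: \<sigma>_def \<tau>_def sgn_if)
  define f :: "real^2 \<Rightarrow> real^2" where "f z = vector [\<sigma> * (u z - c1), \<tau> * (v z - c2)]" for z
  define A :: "real^2^2" where "A = vector [vector [\<sigma> * m1, \<sigma> * m2], vector [\<tau> * p1, \<tau> * p2]]"
  have ne: "(1::2) \<noteq> 2" by auto
  show ?thesis
  proof (rule that[of f "\<bar>k0\<bar>" "\<bar>q0\<bar>" "\<tau> * (a0 + c2)" "\<sigma> * (b0 + c1)"])
    have "det A = \<sigma> * \<tau> * D" by (simp add: det_2 A_def D_def algebra_simps)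
    then have "invertible A" using st D by (simp add: invertible_det_nz)
    moreover have "f = (\<lambda>z. A *v z + vector [- \<sigma> * c1, - \<tau> * c2])"
      by (simp add: fun_eq_iff f_def eq_two[OF ne] matrix_vector_mult_def sum_2 A_def u_def v_def algebra_simps)
    ultimately show "invertible_affine_map f" unfolding invertible_affine_map_def by blast
    show "\<bar>k0\<bar> > 0" "\<bar>q0\<bar> > 0" using kq by auto
    fix z
    have "\<bar>k0\<bar> * (f z $ 2 + \<tau> * (a0 + c2)) = (\<bar>k0\<bar> * \<tau>) * (v z + a0)"
      by (simp add: f_def algebra_simps)
    then show "G z = (f z $ 1)\<^sup>2 - \<bar>k0\<bar> * (f z $ 2 + \<tau> * (a0 + c2))"
      unfolding G st by (simp add: f_def power_mult_distrib st)
    have "\<bar>q0\<bar> * (f z $ 1 + \<sigma> * (b0 + c1)) = (\<bar>q0\<bar> * \<sigma>) * (u z + b0)"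
      by (simp add: f_def algebra_simps)
    then show "G' z = (f z $ 2)\<^sup>2 - \<bar>q0\<bar> * (f z $ 1 + \<sigma> * (b0 + c1))"
      unfolding G' st by (simp add: f_def power_mult_distrib st)
  qed
qed

section \<open>The four vertices and the choice of scale\<close>

lemma four_real_elements:
  fixes X :: "real set"
  assumes "card X = 4"
  obtains x1 x2 x3 x4 where "x1 < x2" "x2 < x3" "x3 < x4" "X = {x1, x2, x3, x4}"
proof -
  have fin: "finite X" using assms by (metis card.infinite zero_neq_numeral)
  define xs where "xs = sorted_list_of_set X"
  have "length xs = Suc (Suc (Suc (Suc 0)))" using assms by (simp add: xs_def)
  then obtain x1 x2 x3 x4 where xs: "xs = [x1, x2, x3, x4]"
    by (auto simp: length_Suc_conv)
  have "sorted_wrt (<) [x1, x2, x3, x4]" using strict_sorted_list_of_set[of X] unfolding xs[symmetric] xs_def .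
  moreover have "X = {x1, x2, x3, x4}" using set_sorted_list_of_set[OF fin] xs by (simp add: xs_def)
  ultimately show ?thesis by (intro that) auto
qed

text \<open>The first equation determines the ordinate from the abscissa, so four vertices mean four
  distinct real roots of the quartic.\<close>

lemma axis_parabola_abscissae:
  assumes "k > 0"
  shows "bij_betw (\<lambda>z. z $ 1) (axis_parabola 1 2 k a \<inter> axis_parabola 2 1 q b)
    {x. (x\<^sup>2 - k * a)\<^sup>2 = k\<^sup>2 * q * (x + b)}"
proof (rule bij_betw_byWitness[where f' = "\<lambda>x. vector [x, x\<^sup>2 / k - a]"])
  have ne: "(1::2) \<noteq> 2" by auto
  show "\<forall>z\<in>axis_parabola 1 2 k a \<inter> axis_parabola 2 1 q b. vector [z $ 1, (z $ 1)\<^sup>2 / k - a] = z"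
    using assms by (simp add: axis_parabola_def eq_two[OF ne])
  show "(\<lambda>z. z $ 1) ` (axis_parabola 1 2 k a \<inter> axis_parabola 2 1 q b)
    \<subseteq> {x. (x\<^sup>2 - k * a)\<^sup>2 = k\<^sup>2 * q * (x + b)}"
    by (auto simp: axis_parabola_def algebra_simps power_mult_distrib)
  have sq: "(x\<^sup>2 / k - a)\<^sup>2 = (x\<^sup>2 - k * a)\<^sup>2 / k\<^sup>2" for x
    using assms by (simp add: field_simps flip: power_divide)
  show "(\<lambda>x. vector [x, x\<^sup>2 / k - a]) ` {x. (x\<^sup>2 - k * a)\<^sup>2 = k\<^sup>2 * q * (x + b)}
    \<subseteq> axis_parabola 1 2 k a \<inter> axis_parabola 2 1 q b"
    using assms by (auto simp: axis_parabola_def sq)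
qed auto

lemma surj_image_eqI:
  assumes "surj f" "\<And>z. z \<in> A \<longleftrightarrow> f z \<in> B"
  shows "f ` A = B"
proof -
  have "A = f -` B" using assms(2) by auto
  then show ?thesis using surj_image_vimage_eq[OF assms(1)] by simp
qed

theorem corollary1:
  fixes Q V :: "(real^2) set" and S :: "(real^2) set set"
  assumes "parabolic_quadrilateral Q V S"
  shows "\<exists>f. invertible_affine_map f \<and>
             parabolic_quadrilateral (f ` Q) (f ` V) ((`) f ` S) \<and>
             inscribed (f ` V) \<and> circumscribed (f ` V) ((`) f ` S)"
proof -
  obtain F1 d1 F2 d2 where
    lines: "is_line d1" "F1 \<notin> d1" "is_line d2" "F2 \<notin> d2" and
    card: "card (parabola F1 d1 \<inter> parabola F2 d2) = 4" and
    Q: "Q = parabola_region F1 d1 \<inter> parabola_region F2 d2" and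
    V: "V = parabola F1 d1 \<inter> parabola F2 d2" and
    S: "S = components (parabola F1 d1 \<inter> frontier Q) \<union> components (parabola F2 d2 \<inter> frontier Q)"
    using assms unfolding parabolic_quadrilateral_def by auto
  obtain m1 m2 c \<kappa> h where eq1: "m1 \<noteq> 0 \<or> m2 \<noteq> 0" "\<kappa> \<noteq> 0"
    "parabola F1 d1 = {z. (m1 * z $ 1 + m2 * z $ 2 - c)\<^sup>2 = \<kappa> * (m1 * z $ 2 - m2 * z $ 1) + h}"
    "parabola_region F1 d1 = {z. (m1 * z $ 1 + m2 * z $ 2 - c)\<^sup>2 \<le> \<kappa> * (m1 * z $ 2 - m2 * z $ 1) + h}"
    by (rule parabola_quadratic_equation[OF lines(1,2)])
  obtain p1 p2 c' \<kappa>' h' where eq2: "p1 \<noteq> 0 \<or> p2 \<noteq> 0" "\<kappa>' \<noteq> 0"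
    "parabola F2 d2 = {z. (p1 * z $ 1 + p2 * z $ 2 - c')\<^sup>2 = \<kappa>' * (p1 * z $ 2 - p2 * z $ 1) + h'}"
    "parabola_region F2 d2 = {z. (p1 * z $ 1 + p2 * z $ 2 - c')\<^sup>2 \<le> \<kappa>' * (p1 * z $ 2 - p2 * z $ 1) + h'}"
    by (rule parabola_quadratic_equation[OF lines(3,4)])
  \<comment> \<open>The vectors \<open>(m1, m2)\<close> and \<open>(p1, p2)\<close> are
    perpendicular to the axes, so this says that the axes are not parallel.\<close>
  have det: "m1 * p2 \<noteq> m2 * p1"
  proof
    assume "m1 * p2 = m2 * p1"
    from common_direction_parabolas[OF eq1(1,2) this] card show False
      unfolding eq1(3) eq2(3) by blast
  qed
  obtain f k a q b where f: "invertible_affine_map f" and k: "k > 0" and q: "q > 0" and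
    G: "\<And>z. (m1 * z $ 1 + m2 * z $ 2 - c)\<^sup>2 - (\<kappa> * (m1 * z $ 2 - m2 * z $ 1) + h)
        = (f z $ 1)\<^sup>2 - k * (f z $ 2 + a)" and
    G': "\<And>z. (p1 * z $ 1 + p2 * z $ 2 - c')\<^sup>2 - (\<kappa>' * (p1 * z $ 2 - p2 * z $ 1) + h')
        = (f z $ 2)\<^sup>2 - q * (f z $ 1 + b)"
    by (rule simultaneous_axis_form[OF eq1(2) eq2(2) det, of c h c' h']) blast
  have sets: "z \<in> parabola F1 d1 \<longleftrightarrow> f z \<in> axis_parabola 1 2 k a"
    "z \<in> parabola_region F1 d1 \<longleftrightarrow> f z \<in> axis_region 1 2 k a"
    "z \<in> parabola F2 d2 \<longleftrightarrow> f z \<in> axis_parabola 2 1 q b"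
    "z \<in> parabola_region F2 d2 \<longleftrightarrow> f z \<in> axis_region 2 1 q b" for z
    using G[of z] G'[of z] unfolding eq1 eq2 axis_parabola_def axis_region_def mem_Collect_eq
    by (intro iffI; linarith)+
  have bij: "bij f" using invertible_affine_map_bij[OF f] .
  have "f ` V = axis_parabola 1 2 k a \<inter> axis_parabola 2 1 q b"
    by (rule surj_image_eqI[OF bij_is_surj[OF bij]]) (simp add: V sets)
  moreover have "card (f ` V) = 4"
    using card card_image[OF inj_on_subset[OF bij_is_inj[OF bij]]] unfolding V by simp
  ultimately have "card {x. (x\<^sup>2 - k * a)\<^sup>2 = k\<^sup>2 * q * (x + b)} = 4"
    using bij_betw_same_card[OF axis_parabola_abscissae[OF k, of a q b]] by simp
  then obtain x1 x2 x3 x4 where less: "x1 < x2" "x2 < x3" "x3 < x4"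
    and "{x. (x\<^sup>2 - k * a)\<^sup>2 = k\<^sup>2 * q * (x + b)} = {x1, x2, x3, x4}" by (rule four_real_elements)
  then have root: "\<forall>x\<in>{x1, x2, x3, x4}. (x\<^sup>2 - k * a)\<^sup>2 = k\<^sup>2 * q * (x + b)" by blast

  \<comment> \<open>Stretching the abscissae by \<open>l\<close> turns \<open>k\<close> into
    \<open>l\<^sup>2 * k\<close> and \<open>x2 + x4\<close> into \<open>l * (x2 + x4)\<close>; this
    \<open>l\<close> makes the two equal. It is positive because the roots sum to 0 and
    \<open>x1 + x3 < x2 + x4\<close>.\<close>
  define l where "l = (x2 + x4) / k"
  have "x2 + x4 > 0" using axis_quartic_factor(1)[OF less root] less by linarith
  then have l: "l > 0" "l * (x2 + x4) = l\<^sup>2 * k"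
    using k by (simp_all add: l_def power2_eq_square)
  define g :: "real^2 \<Rightarrow> real^2" where "g z = vector [l * z $ 1, z $ 2]" for z
  have "invertible_affine_map g"
    unfolding invertible_affine_map_def
  proof (intro exI conjI)
    show "invertible (vector [vector [l, 0], vector [0, 1]] :: real^2^2)"
      using l by (simp add: invertible_det_nz det_2)
    show "g = (\<lambda>z. vector [vector [l, 0], vector [0, 1]] *v z + 0)"
      by (simp add: fun_eq_iff g_def vec_eq_iff forall_2 matrix_vector_mult_def sum_2)
  qed
  then have gf: "invertible_affine_map (g \<circ> f)" using f by (intro invertible_affine_map_compose)
  \<comment> \<open>The second equation is rewritten as
    \<open>y\<^sup>2 = q / l * (l * x + l * b)\<close>, which yields the new parameters
    \<open>q / l\<close> and \<open>l * b\<close>.\<close>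
  define P1 P2 R1 R2 where "P1 = axis_parabola 1 2 (l\<^sup>2 * k) a" and "P2 = axis_parabola 2 1 (q / l) (l * b)"
    and "R1 = axis_region 1 2 (l\<^sup>2 * k) a" and "R2 = axis_region 2 1 (q / l) (l * b)"
  have scale: "q / l * (l * t + l * b) = q * (t + b)" for t
    using l by (simp add: field_simps)
  have "z \<in> parabola F1 d1 \<longleftrightarrow> (g \<circ> f) z \<in> P1" "z \<in> parabola_region F1 d1 \<longleftrightarrow> (g \<circ> f) z \<in> R1"
    "z \<in> parabola F2 d2 \<longleftrightarrow> (g \<circ> f) z \<in> P2" "z \<in> parabola_region F2 d2 \<longleftrightarrow> (g \<circ> f) z \<in> R2" for z
    using l unfolding sets P1_def P2_def R1_def R2_def axis_parabola_def axis_region_def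
    by (simp_all only: o_def g_def vector_2 scale mem_Collect_eq power_mult_distrib mult.assoc) simp_all
  moreover have bij': "bij (g \<circ> f)" using invertible_affine_map_bij[OF gf] .
  ultimately have im: "(g \<circ> f) ` parabola F1 d1 = P1" "(g \<circ> f) ` parabola_region F1 d1 = R1"
    "(g \<circ> f) ` parabola F2 d2 = P2" "(g \<circ> f) ` parabola_region F2 d2 = R2"
    by (intro surj_image_eqI[OF bij_is_surj[OF bij']]; simp)+
  have imQ: "(g \<circ> f) ` Q = R1 \<inter> R2" and imV: "(g \<circ> f) ` V = P1 \<inter> P2"
    unfolding Q V by (simp_all only: image_Int[OF bij_is_inj[OF bij']] im)
  have imS: "(`) (g \<circ> f) ` S = components (P1 \<inter> frontier (R1 \<inter> R2)) \<union> components (P2 \<inter> frontier (R1 \<inter> R2))"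
    unfolding S image_Un invertible_affine_map_components[OF gf, symmetric]
      image_Int[OF bij_is_inj[OF bij']] invertible_affine_map_frontier[OF gf, symmetric] im imQ ..
  have "card (P1 \<inter> P2) = 4"
    unfolding imV[symmetric] using card card_image[OF inj_on_subset[OF bij_is_inj[OF bij']]]
    unfolding V by simp
  moreover have "\<forall>x\<in>{l * x1, l * x2, l * x3, l * x4}.
      (x\<^sup>2 - l\<^sup>2 * k * a)\<^sup>2 = (l\<^sup>2 * k)\<^sup>2 * (q / l) * (x + l * b)"
  proof -
    have "((l * x)\<^sup>2 - l\<^sup>2 * k * a)\<^sup>2 = (l\<^sup>2)\<^sup>2 * (x\<^sup>2 - k * a)\<^sup>2"
      "(l\<^sup>2 * k)\<^sup>2 * (q / l) * (l * x + l * b) = (l\<^sup>2)\<^sup>2 * (k\<^sup>2 * q * (x + b))" for x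
      using scale[of x] by (simp_all add: power2_eq_square algebra_simps)
    then show ?thesis using root by auto
  qed
  ultimately have "parabolic_quadrilateral (R1 \<inter> R2) (P1 \<inter> P2) ((`) (g \<circ> f) ` S)"
    "inscribed (P1 \<inter> P2)" "circumscribed (P1 \<inter> P2) ((`) (g \<circ> f) ` S)"
    unfolding imS P1_def P2_def R1_def R2_def
    using circumscribed_quadrilateral[of "l\<^sup>2 * k" "q / l" "l * x1" "l * x2" "l * x3" "l * x4" a "l * b"]
      k q l less by (simp_all add: distrib_left)
  then show ?thesis using gf imQ imV by (intro exI[of _ "g \<circ> f"]) simp
qed

end
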